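(* Let $N$ be the number of sensors, and let $|\psi_0\rangle\in(\mathbb{C}^2)^{\otimes N}$ be any pure (normalised) $N$-qubit probe state, with local phase encoding and with $\mathcal{F}_Q(\boldsymbol{u}^\top\boldsymbol{\theta})$ denoting the quantum Fisher information for the linear combination $\boldsymbol{u}^\top\boldsymbol{\theta}$. For any two unit vectors $\hat{\boldsymbol{w}},\hat{\boldsymbol{v}}\in\mathbb{R}^N$ with $\hat{\boldsymbol{w}}\perp\hat{\boldsymbol{v}}$, $$\mathcal{F}_Q(\hat{\boldsymbol{w}}^\top\boldsymbol{\theta})+\mathcal{F}_Q(\hat{\boldsymbol{v}}^\top\boldsymbol{\theta})\le N.$$ Moreover, if $N=2$ and $|\psi_0\rangle$ is equatorial, then equality holds for any two such vectors.
   Context: Setting: $N$ sensors each hold one qubit of a normalised pure probe state $|\psi_0\rangle\in(\mathbb{C}^2)^{\otimes N}$. Let $\sigma_z=\mathrm{diag}(1,-1)$ be the Pauli $Z$ operator and $\sigma_z^{(j)}=I\otimes\cdots\otimes\sigma_z\otimes\cdots\otimes I$ with $\sigma_z$ acting on the $j$-th qubit. The encoded state is $|\psi(\boldsymbol{\theta})\rangle=\exp\left(-\frac{i}{2}\sum_{j=1}^N\theta_j\sigma_z^{(j)}\right)|\psi_0\rangle$ with $\boldsymbol{\theta}=(\theta_1,\dots,\theta_N)\in[0,2\pi)^N$. Quantum Fisher information matrix (QFIM): with $\rho(\boldsymbol{\theta})=|\psi(\boldsymbol{\theta})\rangle\langle\psi(\boldsymbol{\theta})|$, $[\mathcal{F}_Q(\boldsymbol{\theta})]_{ij}=\frac12\mathrm{Tr}[\rho(\boldsymbol{\theta})\{L_i,L_j\}]$,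 where $\{A,B\}=AB+BA$ and $L_i$ is the symmetric logarithmic derivative, defined by $\partial\rho(\boldsymbol{\theta})/\partial\theta_i=\{L_i,\rho(\boldsymbol{\theta})\}/2$. For this encoding the QFIM is given by the known formula (which may be taken as its definition) $$[\mathcal{F}_Q(\boldsymbol{\theta})]_{ij}=\langle\sigma_z^{(i)}\sigma_z^{(j)}\rangle-\langle\sigma_z^{(i)}\rangle\langle\sigma_z^{(j)}\rangle,\qquad \langle A\rangle=\langle\psi_0|A|\psi_0\rangle.$$ For $\boldsymbol{u}\in\mathbb{R}^N$, the quantum Fisher information for $\boldsymbol{u}^\top\boldsymbol{\theta}$ is $\mathcal{F}_Q(\boldsymbol{u}^\top\boldsymbol{\theta})=\boldsymbol{u}^\top\mathcal{F}_Q(\boldsymbol{\theta})\boldsymbol{u}$. The probe state $|\psi_0\rangle$ is called equatorial if $\langle\sigma_z^{(j)}\rangle=0$ for all $j$. *)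

theory Defs
  imports "HOL-Analysis.Analysis"
begin

text \<open>
  The sensors are the elements of a finite type \<open>'n\<close>, so the number of sensors is
  \<open>CARD('n)\<close>.  The computational basis of the N-fold tensor power of the qubit space is indexed
  by \<open>'n \<Rightarrow> bool\<close>: the basis vector with index \<open>b\<close> is the tensor product over all sensors
  \<open>j\<close> of the basis vector \<open>b j\<close> of the \<open>j\<close>-th qubit, where \<open>False\<close> and
  \<open>True\<close> stand for the eigenvectors of the Pauli Z operator with eigenvalues 1 and -1.
\<close>

type_synonym 'n state = "complex ^ ('n \<Rightarrow> bool)"
type_synonym 'n operator = "complex ^ ('n \<Rightarrow> bool) ^ ('n \<Rightarrow> bool)"

definition tensor_op :: "('n::finite \<Rightarrow> complex ^ bool ^ bool) \<Rightarrow> 'n operator"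
  where "tensor_op A = (\<chi> a b. \<Prod>j\<in>UNIV. A j $ a j $ b j)"

definition pauli_z :: "complex ^ bool ^ bool"
  where "pauli_z = (\<chi> a b. if a = b then (if a then - 1 else 1) else 0)"

definition sigma_z :: "'n::finite \<Rightarrow> 'n operator"
  where "sigma_z j = tensor_op (\<lambda>k. if k = j then pauli_z else mat 1)"

definition braket :: "'n::finite state \<Rightarrow> 'n state \<Rightarrow> complex"
  where "braket \<phi> \<psi> = (\<Sum>b\<in>UNIV. cnj (\<phi> $ b) * \<psi> $ b)"

definition expectation :: "'n::finite state \<Rightarrow> 'n operator \<Rightarrow> complex"
  where "expectation \<psi> A = braket \<psi> (A *v \<psi>)"

definition equatorial :: "'n::finite state \<Rightarrow> bool"
  where "equatorial \<psi> \<longleftrightarrow> (\<forall>j. expectation \<psi> (sigma_z j) = 0)"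

text \<open>
  The library function \<open>exp\<close> is not available for matrices, whose type-class multiplication
  is componentwise; hence the exponential series is written out with the matrix product.
\<close>

definition matrix_exp :: "complex ^ 'm ^ 'm \<Rightarrow> complex ^ 'm::finite ^ 'm"
  where "matrix_exp A = (\<Sum>k. ((**) A ^^ k) (mat 1) /\<^sub>R fact k)"

definition encoded_state :: "'n::finite state \<Rightarrow> real ^ 'n \<Rightarrow> 'n state"
  where "encoded_state \<psi>\<^sub>0 \<theta> =
    matrix_exp (mat (- \<i> / 2) ** (\<Sum>j\<in>UNIV. \<theta> $ j *\<^sub>R sigma_z j)) *v \<psi>\<^sub>0"

definition density_op :: "'n::finite state \<Rightarrow> 'n operator"
  where "density_op \<psi> = (\<chi> a b. \<psi> $ a * cnj (\<psi> $ b))"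

definition anticommutator :: "complex ^ 'm ^ 'm \<Rightarrow> complex ^ 'm ^ 'm \<Rightarrow> complex ^ 'm::finite ^ 'm"
  where "anticommutator A B = A ** B + B ** A"

definition is_SLD :: "'n::finite state \<Rightarrow> real ^ 'n \<Rightarrow> 'n \<Rightarrow> 'n operator \<Rightarrow> bool"
  where "is_SLD \<psi>\<^sub>0 \<theta> i L \<longleftrightarrow>
    ((\<lambda>t. density_op (encoded_state \<psi>\<^sub>0 (\<theta> + t *\<^sub>R axis i 1))) has_vector_derivative
      (1 / 2) *\<^sub>R anticommutator L (density_op (encoded_state \<psi>\<^sub>0 \<theta>))) (at 0)"

text \<open>
  For a pure state the equation defining the symmetric logarithmic derivative has many solutions.
  Solutions exist (\<open>ex_SLD\<close>) and the trace in \<open>qfim\<close> is the same for all of them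
  (\<open>trace_SLD\<close>) and real (\<open>qfim_eq_covariance\<close>), so neither the choice nor
  taking the real part loses anything.
\<close>

definition SLD :: "'n::finite state \<Rightarrow> real ^ 'n \<Rightarrow> 'n \<Rightarrow> 'n operator"
  where "SLD \<psi>\<^sub>0 \<theta> i = (SOME L. is_SLD \<psi>\<^sub>0 \<theta> i L)"

definition qfim :: "'n::finite state \<Rightarrow> real ^ 'n \<Rightarrow> real ^ 'n ^ 'n"
  where "qfim \<psi>\<^sub>0 \<theta> = (\<chi> i j. Re ((1 / 2) *
    trace (density_op (encoded_state \<psi>\<^sub>0 \<theta>) ** anticommutator (SLD \<psi>\<^sub>0 \<theta> i) (SLD \<psi>\<^sub>0 \<theta> j))))"

definition qfi :: "'n::finite state \<Rightarrow> real ^ 'n \<Rightarrow> real ^ 'n \<Rightarrow> real"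
  where "qfi \<psi>\<^sub>0 \<theta> u = u \<bullet> (qfim \<psi>\<^sub>0 \<theta> *v u)"


subsection \<open>Well-definedness and the covariance formula\<close>

definition zsign :: "'n \<Rightarrow> ('n \<Rightarrow> bool) \<Rightarrow> complex"
  where "zsign j b = (if b j then - 1 else 1)"

definition diag :: "('m \<Rightarrow> complex) \<Rightarrow> complex ^ 'm ^ 'm::finite"
  where "diag f = (\<chi> a b. if a = b then f a else 0)"

lemma cnj_zsign [simp]: "cnj (zsign j b) = zsign j b"
  by (simp add: zsign_def)

lemma sigma_z_eq_diag: "sigma_z j = diag (zsign j)"
proof -
  have "(\<Prod>k\<in>UNIV. (if k = j then pauli_z else mat 1) $ a k $ b k)
      = (if a = b then zsign j a else 0)" for a b :: "'a \<Rightarrow> bool"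
  proof (cases "a = b")
    case True
    have "(\<Prod>k\<in>UNIV. (if k = j then pauli_z else mat 1) $ a k $ a k)
        = (\<Prod>k\<in>UNIV. if k = j then zsign j a else 1)"
      by (rule prod.cong) (auto simp: pauli_z_def mat_def zsign_def)
    then show ?thesis using True by simp
  next
    case False
    then obtain k where "a k \<noteq> b k" by auto
    then have "(if k = j then pauli_z else mat 1) $ a k $ b k = 0"
      by (auto simp: pauli_z_def mat_def)
    then have "(\<Prod>k\<in>UNIV. (if k = j then pauli_z else mat 1) $ a k $ b k) = 0"
      by (intro prod_zero bexI[of _ k]) simp_all
    then show ?thesis using False by simp
  qed
  then show ?thesis
    by (simp add: sigma_z_def tensor_op_def diag_def vec_eq_iff)
qed

lemma diag_mult_nth: "(diag f ** A) $ a $ b = f a * A $ a $ b" "(A ** diag f) $ a $ b = A $ a $ b * f b"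
  by (simp_all add: diag_def matrix_matrix_mult_def if_distrib[where f="\<lambda>u. u * _"]
      if_distrib[where f="\<lambda>u. _ * u"] cong: if_cong)

lemma diag_mult: "diag f ** diag g = diag (\<lambda>a. f a * g a)"
  unfolding vec_eq_iff diag_mult_nth by (simp add: diag_def)

lemma mat_eq_diag: "mat c = diag (\<lambda>_. c)"
  by (simp add: mat_def diag_def)

lemma sum_scaleR_diag: "(\<Sum>j\<in>S. c j *\<^sub>R diag (f j)) = diag (\<lambda>a. \<Sum>j\<in>S. c j *\<^sub>R f j a)"
  by (simp add: diag_def vec_eq_iff if_distrib cong: if_cong)

lemma diag_mult_vec: "(diag f *v x) $ a = f a * x $ a"
  by (simp add: diag_def matrix_vector_mult_def if_distrib[where f="\<lambda>u. u * _"] cong: if_cong)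

lemma matrix_exp_diag: "matrix_exp (diag f) = diag (\<lambda>a. exp (f a))"
proof -
  have pow: "((**) (diag f) ^^ k) (mat 1) = diag (\<lambda>a. f a ^ k)" for k
    by (induction k) (simp_all add: mat_eq_diag diag_mult)
  have "(\<lambda>k. diag (\<lambda>a. f a ^ k) /\<^sub>R fact k) sums diag (\<lambda>a. exp (f a))"
    unfolding sums_def
  proof (intro vec_tendstoI)
    fix a b
    show "(\<lambda>n. (\<Sum>k<n. diag (\<lambda>a. f a ^ k) /\<^sub>R fact k) $ a $ b)
        \<longlonglongrightarrow> diag (\<lambda>a. exp (f a)) $ a $ b"
      using exp_converges[of "f a"]
      by (cases "a = b") (simp_all add: diag_def sums_def)
  qed
  then show ?thesis
    unfolding matrix_exp_def pow by (rule sums_unique[symmetric])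
qed

lemma encoded_state_nth:
  "encoded_state \<psi> \<theta> $ b = exp (- \<i> / 2 * (\<Sum>j\<in>UNIV. \<theta> $ j *\<^sub>R zsign j b)) * \<psi> $ b"
  unfolding encoded_state_def sigma_z_eq_diag sum_scaleR_diag mat_eq_diag diag_mult
    matrix_exp_diag diag_mult_vec ..

lemma expectation_diag: "expectation \<psi> (diag f) = (\<Sum>a\<in>UNIV. f a * (\<psi> $ a * cnj (\<psi> $ a)))"
  by (simp add: expectation_def braket_def diag_mult_vec mult_ac)

lemma density_encoded_nth:
  "density_op (encoded_state \<psi> \<theta>) $ a $ b =
    exp (- \<i> / 2 * (\<Sum>j\<in>UNIV. \<theta> $ j *\<^sub>R (zsign j a - zsign j b))) * (\<psi> $ a * cnj (\<psi> $ b))"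
proof -
  let ?s = "\<lambda>b. \<Sum>j\<in>UNIV. \<theta> $ j *\<^sub>R zsign j b"
  have "cnj (?s b) = ?s b"
    by (simp add: scaleR_conv_of_real)
  then have "cnj (exp (- \<i> / 2 * ?s b)) = exp (\<i> / 2 * ?s b)"
    by (simp only: exp_cnj complex_cnj_mult) simp
  moreover have "exp (- \<i> / 2 * (\<Sum>j\<in>UNIV. \<theta> $ j *\<^sub>R (zsign j a - zsign j b)))
      = exp (- \<i> / 2 * ?s a) * exp (\<i> / 2 * ?s b)"
    by (simp add: exp_add[symmetric] scaleR_diff_right sum_subtractf algebra_simps)
  ultimately show ?thesis
    by (simp add: density_op_def encoded_state_nth mult_ac)
qed

lemma has_vector_derivative_vecI:
  fixes f :: "real \<Rightarrow> 'a::real_normed_vector ^ 'm::finite"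
  assumes "\<And>a. ((\<lambda>t. f t $ a) has_vector_derivative D $ a) (at x)"
  shows "(f has_vector_derivative D) (at x)"
  using assms unfolding has_vector_derivative_def has_derivative_at_within
  by (auto intro!: vec_tendstoI bounded_linear_scaleR_left)

lemma deriv_density:
  "((\<lambda>t. density_op (encoded_state \<psi> (\<theta> + t *\<^sub>R axis i 1))) has_vector_derivative
    (\<chi> a b. - \<i> / 2 * (zsign i a - zsign i b) * density_op (encoded_state \<psi> \<theta>) $ a $ b)) (at 0)"
proof (intro has_vector_derivative_vecI)
  fix a b :: "'a \<Rightarrow> bool"
  define s where "s = (\<Sum>j\<in>UNIV. \<theta> $ j *\<^sub>R (zsign j a - zsign j b))"
  define d where "d = zsign i a - zsign i b"
  define c where "c = \<psi> $ a * cnj (\<psi> $ b)"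
  have *: "(\<Sum>j\<in>UNIV. (\<theta> + t *\<^sub>R axis i 1) $ j *\<^sub>R (zsign j a - zsign j b)) = s + t *\<^sub>R d" for t
  proof -
    have "(\<Sum>j\<in>UNIV. (t *\<^sub>R axis i 1) $ j *\<^sub>R (zsign j a - zsign j b))
        = (\<Sum>j\<in>UNIV. if j = i then t *\<^sub>R d else 0)"
      by (rule sum.cong) (auto simp: axis_def d_def)
    then show ?thesis
      by (simp add: s_def scaleR_left_distrib sum.distrib)
  qed
  have "((\<lambda>z. exp (- \<i> / 2 * (s + z * d)) * c) has_field_derivative
      - \<i> / 2 * d * (exp (- \<i> / 2 * s) * c)) (at (of_real 0))"
    by (auto intro!: derivative_eq_intros)
  then have "((\<lambda>t. exp (- \<i> / 2 * (s + of_real t * d)) * c) has_vector_derivative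
      - \<i> / 2 * d * (exp (- \<i> / 2 * s) * c)) (at 0)"
    using has_vector_derivative_real_field by blast
  then show "((\<lambda>t. density_op (encoded_state \<psi> (\<theta> + t *\<^sub>R axis i 1)) $ a $ b) has_vector_derivative
    (\<chi> a b. - \<i> / 2 * (zsign i a - zsign i b) * density_op (encoded_state \<psi> \<theta>) $ a $ b) $ a $ b) (at 0)"
    unfolding density_encoded_nth * by (simp add: s_def d_def c_def scaleR_conv_of_real)
qed

lemma sum_norm_encoded:
  assumes "norm \<psi> = 1"
  shows "(\<Sum>a\<in>UNIV. encoded_state \<psi> \<theta> $ a * cnj (encoded_state \<psi> \<theta> $ a)) = 1"
proof -
  have "encoded_state \<psi> \<theta> $ a * cnj (encoded_state \<psi> \<theta> $ a) = of_real ((norm (\<psi> $ a))\<^sup>2)" for a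
    using density_encoded_nth[of \<psi> \<theta> a a]
    by (simp add: density_op_def complex_norm_square[symmetric] del: of_real_power)
  then have "(\<Sum>a\<in>UNIV. encoded_state \<psi> \<theta> $ a * cnj (encoded_state \<psi> \<theta> $ a))
      = of_real ((norm \<psi>)\<^sup>2)"
    by (simp add: norm_vec_def L2_set_def sum_nonneg)
  then show ?thesis using assms by simp
qed

lemma density_idem:
  assumes "norm \<psi> = 1"
  shows "density_op (encoded_state \<psi> \<theta>) ** density_op (encoded_state \<psi> \<theta>) = density_op (encoded_state \<psi> \<theta>)"
proof -
  let ?e = "encoded_state \<psi> \<theta>"
  have "(\<Sum>c\<in>UNIV. ?e $ a * cnj (?e $ c) * (?e $ c * cnj (?e $ b))) = ?e $ a * cnj (?e $ b)" for a b
  proof -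
    have "(\<Sum>c\<in>UNIV. ?e $ a * cnj (?e $ c) * (?e $ c * cnj (?e $ b)))
        = ?e $ a * cnj (?e $ b) * (\<Sum>c\<in>UNIV. ?e $ c * cnj (?e $ c))"
      by (simp add: sum_distrib_left mult_ac)
    then show ?thesis using sum_norm_encoded[OF assms] by simp
  qed
  then show ?thesis
    by (simp add: density_op_def matrix_matrix_mult_def vec_eq_iff)
qed

abbreviation (input) partial_density :: "'n::finite state \<Rightarrow> real ^ 'n \<Rightarrow> 'n \<Rightarrow> 'n operator"
  where "partial_density \<psi> \<theta> i \<equiv>
    (\<chi> a b. - \<i> / 2 * (zsign i a - zsign i b) * density_op (encoded_state \<psi> \<theta>) $ a $ b)"

lemma is_SLD_iff:
  "is_SLD \<psi> \<theta> i L \<longleftrightarrow>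
    (1 / 2) *\<^sub>R anticommutator L (density_op (encoded_state \<psi> \<theta>)) = partial_density \<psi> \<theta> i"
  unfolding is_SLD_def
  using deriv_density[of \<psi> \<theta> i]
  by (auto dest: vector_derivative_unique_at[OF _ deriv_density[of \<psi> \<theta> i]])

lemma partial_density_anticommutator:
  assumes "norm \<psi> = 1"
  shows "anticommutator (partial_density \<psi> \<theta> i) (density_op (encoded_state \<psi> \<theta>))
    = partial_density \<psi> \<theta> i"
proof -
  let ?r = "density_op (encoded_state \<psi> \<theta>)" and ?z = "diag (zsign i)"
  have D: "partial_density \<psi> \<theta> i = mat (- \<i> / 2) ** (?z ** ?r - ?r ** ?z)"
    by (simp add: vec_eq_iff mat_eq_diag diag_mult_nth algebra_simps)
  have comm: "A ** (mat c ** B) = mat c ** (A ** B)" for c and A B :: "'a operator"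
  proof -
    have "A ** mat c = mat c ** A" by (simp add: vec_eq_iff mat_eq_diag diag_mult_nth)
    then show ?thesis by (simp add: matrix_mul_assoc)
  qed
  have sub_rdistrib: "(A - B) ** C = A ** C - B ** C" and
    sub_ldistrib: "C ** (A - B) = C ** A - C ** B" for A B C :: "'a operator"
    by (simp_all add: matrix_matrix_mult_def vec_eq_iff algebra_simps sum_subtractf)
  note idem = density_idem[OF assms, of \<theta>]
  have "(?z ** ?r - ?r ** ?z) ** ?r + ?r ** (?z ** ?r - ?r ** ?z) = ?z ** ?r - ?r ** ?z"
  proof -
    have "(?z ** ?r - ?r ** ?z) ** ?r = ?z ** ?r - ?r ** ?z ** ?r"
      by (simp add: sub_rdistrib matrix_mul_assoc[symmetric] idem)
    moreover have "?r ** (?z ** ?r - ?r ** ?z) = ?r ** ?z ** ?r - ?r ** ?z"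
      by (simp add: sub_ldistrib matrix_mul_assoc idem)
    ultimately show ?thesis by simp
  qed
  then show ?thesis
    unfolding D anticommutator_def comm
    by (simp only: matrix_mul_assoc[symmetric] matrix_add_ldistrib[symmetric])
qed

lemma ex_SLD:
  assumes "norm \<psi> = 1"
  shows "\<exists>L. is_SLD \<psi> \<theta> i L"
proof
  have "anticommutator (2 *\<^sub>R A) B = 2 *\<^sub>R anticommutator A B" for A B :: "'a operator"
    by (simp add: anticommutator_def matrix_matrix_mult_def vec_eq_iff scaleR_sum_right
        scaleR_add_right)
  then show "is_SLD \<psi> \<theta> i (2 *\<^sub>R partial_density \<psi> \<theta> i)"
    unfolding is_SLD_iff using partial_density_anticommutator[OF assms, where \<theta> = \<theta> and i = i] by simp
qed

lemma trace_SLD: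
  assumes "norm \<psi> = 1" and "is_SLD \<psi> \<theta> i L" and "is_SLD \<psi> \<theta> j M"
  shows "(1 / 2) * trace (density_op (encoded_state \<psi> \<theta>) ** anticommutator L M)
    = expectation \<psi> (sigma_z i ** sigma_z j)
      - expectation \<psi> (sigma_z i) * expectation \<psi> (sigma_z j)"
proof -
  let ?r = "density_op (encoded_state \<psi> \<theta>)"
  let ?D = "partial_density \<psi> \<theta>"
  define p where "p a = \<psi> $ a * cnj (\<psi> $ a)" for a
  have aL: "L ** ?r + ?r ** L = 2 *\<^sub>R ?D i" and aM: "M ** ?r + ?r ** M = 2 *\<^sub>R ?D j"
    using assms(2,3) unfolding is_SLD_iff anticommutator_def by (auto dest: sym)
  have tr2: "trace (A ** (2 *\<^sub>R B)) = 2 * trace (A ** B)" for A B :: "'a operator"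
    by (simp add: trace_def matrix_matrix_mult_def sum_distrib_left scaleR_conv_of_real mult_ac)
  have "trace (?r ** anticommutator L M) = trace (L ** (M ** ?r + ?r ** M))"
    using trace_mul_sym[of ?r "L ** M"] trace_mul_sym[of "?r ** M" L]
    by (simp add: anticommutator_def matrix_add_ldistrib trace_add matrix_mul_assoc)
  also have "\<dots> = 2 * trace (L ** ?D j)"
    by (simp only: aM tr2)
  also have "trace (L ** ?D j) = trace (L ** (?D j ** ?r + ?r ** ?D j))"
    using partial_density_anticommutator[OF assms(1), where \<theta> = \<theta> and i = j] unfolding anticommutator_def by simp
  also have "\<dots> = trace (?D j ** (L ** ?r + ?r ** L))"
    using trace_mul_sym[of "L ** ?D j" ?r] trace_mul_sym[of "L ** ?r" "?D j"]
      trace_mul_sym[of "?r ** L" "?D j"]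
    by (simp only: matrix_add_ldistrib trace_add matrix_mul_assoc add.commute)
  also have "\<dots> = 2 * trace (?D j ** ?D i)"
    by (simp only: aL tr2)
  finally have "(1 / 2) * trace (?r ** anticommutator L M) = 2 * trace (?D j ** ?D i)"
    by simp
  also have "trace (?D j ** ?D i) = (\<Sum>a\<in>UNIV. \<Sum>b\<in>UNIV.
      (zsign i a - zsign i b) * (zsign j a - zsign j b) * (p a * p b)) / 4"
  proof -
    have rr: "?r $ a $ b * ?r $ b $ a = p a * p b" for a b
    proof -
      have "?r $ a $ b * ?r $ b $ a = ?r $ a $ a * ?r $ b $ b" by (simp add: density_op_def)
      then show ?thesis by (simp add: density_encoded_nth p_def)
    qed
    have "- \<i> / 2 * (zsign j a - zsign j b) * ?r $ a $ b * (- \<i> / 2 * (zsign i b - zsign i a) * ?r $ b $ a)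
      = (zsign i a - zsign i b) * (zsign j a - zsign j b) * (p a * p b) / 4" for a b
      unfolding rr[symmetric] by (simp add: field_simps)
    then show ?thesis
      by (simp only: trace_def matrix_matrix_mult_def vec_lambda_beta sum_divide_distrib)
  qed
  finally have *: "(1 / 2) * trace (?r ** anticommutator L M) = (\<Sum>a\<in>UNIV. \<Sum>b\<in>UNIV.
      (zsign i a - zsign i b) * (zsign j a - zsign j b) * (p a * p b)) / 2"
    by simp
  have p1: "(\<Sum>a\<in>UNIV. p a) = 1"
    using sum_norm_encoded[OF assms(1), of 0] by (simp add: p_def encoded_state_nth)
  have "(\<Sum>a\<in>UNIV. \<Sum>b\<in>UNIV. (zsign i a - zsign i b) * (zsign j a - zsign j b) * (p a * p b))
    = (\<Sum>a\<in>UNIV. \<Sum>b\<in>UNIV. (zsign i a * zsign j a * p a) * p b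
        + p a * (zsign i b * zsign j b * p b)
        - (zsign i a * p a) * (zsign j b * p b) - (zsign j a * p a) * (zsign i b * p b))"
    by (intro sum.cong refl) algebra
  also have "\<dots> = (\<Sum>a\<in>UNIV. zsign i a * zsign j a * p a) * (\<Sum>b\<in>UNIV. p b)
      + (\<Sum>a\<in>UNIV. p a) * (\<Sum>b\<in>UNIV. zsign i b * zsign j b * p b)
      - (\<Sum>a\<in>UNIV. zsign i a * p a) * (\<Sum>b\<in>UNIV. zsign j b * p b)
      - (\<Sum>a\<in>UNIV. zsign j a * p a) * (\<Sum>b\<in>UNIV. zsign i b * p b)"
    by (simp only: sum.distrib sum_subtractf sum_product)
  finally show ?thesis
    unfolding * p1 sigma_z_eq_diag diag_mult expectation_diag p_def[symmetric] by simp
qed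

lemma qfim_eq_covariance:
  assumes "norm \<psi> = 1"
  shows "of_real (qfim \<psi> \<theta> $ i $ j) = expectation \<psi> (sigma_z i ** sigma_z j)
      - expectation \<psi> (sigma_z i) * expectation \<psi> (sigma_z j)"
proof -
  have "is_SLD \<psi> \<theta> k (SLD \<psi> \<theta> k)" for k
    unfolding SLD_def using ex_SLD[OF assms] by (rule someI_ex)
  note tr = trace_SLD[OF assms this this, of i j]
  have "cnj (expectation \<psi> (diag f)) = expectation \<psi> (diag f)" if "\<And>a. cnj (f a) = f a" for f
    unfolding expectation_diag by (simp add: that mult_ac)
  then have "cnj (expectation \<psi> (sigma_z i ** sigma_z j)
      - expectation \<psi> (sigma_z i) * expectation \<psi> (sigma_z j))
    = expectation \<psi> (sigma_z i ** sigma_z j)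
      - expectation \<psi> (sigma_z i) * expectation \<psi> (sigma_z j)"
    by (simp add: sigma_z_eq_diag diag_mult)
  then show ?thesis
    unfolding qfim_def vec_lambda_beta tr by (simp only: Reals_cnj_iff[symmetric] of_real_Re)
qed

end

theory Submission
  imports Defs
begin

text \<open>
  In the computational basis every \<open>\<sigma>\<^sub>z\<close> is diagonal, so the Fisher information matrix is the
  covariance matrix of a random vector \<open>s \<in> {1, -1}\<^sup>N\<close> distributed with probabilities
  \<open>\<bar>\<psi>\<^sub>0(b)\<bar>\<^sup>2\<close>.  The Fisher information along \<open>u\<close> is the variance of \<open>u \<bullet> s\<close>, hence at most
  the mean of \<open>(u \<bullet> s)\<^sup>2\<close>, and Bessel's inequality bounds \<open>(w \<bullet> s)\<^sup>2 + (v \<bullet> s)\<^sup>2\<close> by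
  \<open>\<bar>s\<bar>\<^sup>2 = N\<close>.  For \<open>N = 2\<close> this is Parseval's identity, and an equatorial state has mean zero.
\<close>

text \<open>The joint eigenvalues of the \<open>sigma_z j\<close> on the basis vector
  \<open>b\<close>, taken as a real vector so that the geometry of \<open>real ^ 'n\<close> applies
  to them.\<close>

definition spin :: "('n::finite \<Rightarrow> bool) \<Rightarrow> real ^ 'n"
  where "spin b = (\<chi> j. if b j then - 1 else 1)"

definition mean_spin :: "'n::finite state \<Rightarrow> real ^ 'n"
  where "mean_spin \<psi> = (\<Sum>b\<in>UNIV. (norm (\<psi> $ b))\<^sup>2 *\<^sub>R spin b)"

lemma zsign_eq_spin: "zsign j b = of_real (spin b $ j)"
  by (simp add: zsign_def spin_def)

lemma inner_spin_self: "spin (b :: 'n::finite \<Rightarrow> bool) \<bullet> spin b = real CARD('n)"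
proof -
  have "spin b $ j * spin b $ j = 1" for j
    by (simp add: spin_def)
  then show ?thesis
    by (simp add: inner_vec_def)
qed

lemma expectation_sigma_z: "expectation \<psi> (sigma_z j) = of_real (mean_spin \<psi> $ j)"
  unfolding sigma_z_eq_diag expectation_diag zsign_eq_spin mean_spin_def
  by (simp add: complex_norm_square[symmetric] mult.commute del: of_real_power)

lemma expectation_sigma_z_mult:
  "expectation \<psi> (sigma_z i ** sigma_z j)
    = of_real (\<Sum>b\<in>UNIV. (norm (\<psi> $ b))\<^sup>2 * (spin b $ i * spin b $ j))"
  unfolding sigma_z_eq_diag diag_mult expectation_diag zsign_eq_spin
  by (simp add: complex_norm_square[symmetric] mult_ac del: of_real_power)

lemma qfim_nth:
  assumes "norm \<psi> = 1"
  shows "qfim \<psi> \<theta> $ i $ j = (\<Sum>b\<in>UNIV. (norm (\<psi> $ b))\<^sup>2 * (spin b $ i * spin b $ j))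
    - mean_spin \<psi> $ i * mean_spin \<psi> $ j"
  \<comment> \<open>The covariance formula lives in the complex numbers; once its right side is a
    single \<open>of_real\<close> term, injectivity of \<open>of_real\<close> brings it down to the
    reals.\<close>
  using qfim_eq_covariance[OF assms, of \<theta> i j]
  unfolding expectation_sigma_z expectation_sigma_z_mult of_real_mult[symmetric] of_real_diff[symmetric]
  by (simp only: of_real_eq_iff)

lemma qfi_eq_variance:
  assumes "norm \<psi> = 1"
  shows "qfi \<psi> \<theta> u
    = (\<Sum>b\<in>UNIV. (norm (\<psi> $ b))\<^sup>2 * (u \<bullet> spin b)\<^sup>2) - (u \<bullet> mean_spin \<psi>)\<^sup>2"
proof -
  \<comment> \<open>Needed for \<open>spin b\<close>, giving the second moment, and for
    \<open>mean_spin \<psi>\<close>, giving the square of the mean.\<close>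
  have sq: "(u \<bullet> x)\<^sup>2 = (\<Sum>i\<in>UNIV. \<Sum>j\<in>UNIV. u $ i * u $ j * (x $ i * x $ j))" for x
    by (simp add: power2_eq_square inner_vec_def sum_product mult_ac)
  have "(\<Sum>b\<in>UNIV. (norm (\<psi> $ b))\<^sup>2 * (u \<bullet> spin b)\<^sup>2)
      = (\<Sum>b\<in>UNIV. \<Sum>i\<in>UNIV. \<Sum>j\<in>UNIV. u $ i * u $ j * ((norm (\<psi> $ b))\<^sup>2 * (spin b $ i * spin b $ j)))"
    unfolding sq by (simp add: sum_distrib_left mult_ac)
  also have "\<dots> = (\<Sum>i\<in>UNIV. \<Sum>b\<in>UNIV. \<Sum>j\<in>UNIV. u $ i * u $ j * ((norm (\<psi> $ b))\<^sup>2 * (spin b $ i * spin b $ j)))"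
    by (rule sum.swap)
  also have "\<dots> = (\<Sum>i\<in>UNIV. \<Sum>j\<in>UNIV. \<Sum>b\<in>UNIV. u $ i * u $ j * ((norm (\<psi> $ b))\<^sup>2 * (spin b $ i * spin b $ j)))"
    by (intro sum.cong refl sum.swap)
  also have "\<dots> = (\<Sum>i\<in>UNIV. \<Sum>j\<in>UNIV. u $ i * u $ j * (\<Sum>b\<in>UNIV. (norm (\<psi> $ b))\<^sup>2 * (spin b $ i * spin b $ j)))"
    by (simp only: sum_distrib_left)
  finally have "(\<Sum>b\<in>UNIV. (norm (\<psi> $ b))\<^sup>2 * (u \<bullet> spin b)\<^sup>2) - (u \<bullet> mean_spin \<psi>)\<^sup>2
      = (\<Sum>i\<in>UNIV. \<Sum>j\<in>UNIV. u $ i * u $ j * qfim \<psi> \<theta> $ i $ j)"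
    unfolding sq qfim_nth[OF assms] by (simp only: right_diff_distrib sum_subtractf)
  then show ?thesis
    by (simp add: qfi_def inner_vec_def matrix_vector_mult_def sum_distrib_left mult_ac)
qed

text \<open>Pythagoras for the projection of \<open>x\<close> to the plane of \<open>w\<close> and
  \<open>v\<close>. A nonnegative residual gives Bessel, a vanishing one Parseval.\<close>

lemma norm_orthonormal_residual:
  fixes x w v :: "'a::real_inner"
  assumes "norm w = 1" "norm v = 1" "orthogonal w v"
  shows "(norm (x - (w \<bullet> x) *\<^sub>R w - (v \<bullet> x) *\<^sub>R v))\<^sup>2 = x \<bullet> x - (w \<bullet> x)\<^sup>2 - (v \<bullet> x)\<^sup>2"
proof -
  have "w \<bullet> w = 1" "v \<bullet> v = 1" "w \<bullet> v = 0" "v \<bullet> w = 0"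
    using assms by (simp_all add: orthogonal_def norm_eq_1 inner_commute)
  then show ?thesis
    unfolding power2_norm_eq_inner
    by (simp add: inner_diff inner_commute power2_eq_square algebra_simps)
qed

lemma Bessel_two:
  fixes x w v :: "'a::real_inner"
  assumes "norm w = 1" "norm v = 1" "orthogonal w v"
  shows "(w \<bullet> x)\<^sup>2 + (v \<bullet> x)\<^sup>2 \<le> x \<bullet> x"
  using norm_orthonormal_residual[OF assms, of x] zero_le_power2[of "norm (x - (w \<bullet> x) *\<^sub>R w - (v \<bullet> x) *\<^sub>R v)"]
  by linarith

lemma Parseval_two:
  fixes x w v :: "'a::euclidean_space"
  assumes on: "norm w = 1" "norm v = 1" "orthogonal w v" and dim: "DIM('a) = 2"
  shows "(w \<bullet> x)\<^sup>2 + (v \<bullet> x)\<^sup>2 = x \<bullet> x"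
proof -
  define r where "r = x - (w \<bullet> x) *\<^sub>R w - (v \<bullet> x) *\<^sub>R v"
  have ip: "w \<bullet> w = 1" "v \<bullet> v = 1" "w \<bullet> v = 0" "v \<bullet> w = 0"
    using on by (simp_all add: orthogonal_def norm_eq_1 inner_commute)
  then have "w \<noteq> v" "w \<noteq> 0" "v \<noteq> 0"
    by auto
  then have "card {w, v} = 2" "0 \<notin> {w, v}"
    by auto
  moreover have "pairwise orthogonal {w, v}"
    using ip by (auto simp: pairwise_def orthogonal_def)
  ultimately have "independent {w, v}" and "card {w, v} = 2"
    using pairwise_orthogonal_independent by blast+
  \<comment> \<open>Two independent vectors in dimension two form a basis.\<close>
  then have "span {w, v} = UNIV"
    using card_ge_dim_independent[of "{w, v}" UNIV] dim by (auto simp: dim_UNIV)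
  moreover have "orthogonal r y" if "y \<in> span {w, v}" for y
    using that by (rule orthogonal_to_span)
      (auto simp: r_def orthogonal_def inner_diff ip inner_commute)
  \<comment> \<open>The residual is orthogonal to the whole space, hence to itself.\<close>
  ultimately have "r = 0"
    by (metis UNIV_I orthogonal_self)
  then show ?thesis
    using norm_orthonormal_residual[OF on, of x] by (simp add: r_def)
qed

lemma sum_norm_square_nth:
  fixes x :: "'a::real_normed_vector ^ 'm::finite"
  shows "(\<Sum>b\<in>UNIV. (norm (x $ b))\<^sup>2) = (norm x)\<^sup>2"
  by (simp add: norm_vec_def L2_set_def sum_nonneg)

theorem theorem1:
  fixes \<psi>\<^sub>0 :: "'n::finite state"
    and \<theta> w v :: "real ^ 'n"
  assumes "norm \<psi>\<^sub>0 = 1"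
    and "\<forall>j. 0 \<le> \<theta> $ j \<and> \<theta> $ j < 2 * pi"
    and "norm w = 1" and "norm v = 1" and "orthogonal w v"
  shows "qfi \<psi>\<^sub>0 \<theta> w + qfi \<psi>\<^sub>0 \<theta> v \<le> real CARD('n) \<and>
    (CARD('n) = 2 \<and> equatorial \<psi>\<^sub>0 \<longrightarrow> qfi \<psi>\<^sub>0 \<theta> w + qfi \<psi>\<^sub>0 \<theta> v = real CARD('n))"
proof -
  let ?p = "\<lambda>b. (norm (\<psi>\<^sub>0 $ b))\<^sup>2"
  let ?Q = "\<Sum>b\<in>UNIV. ?p b * ((w \<bullet> spin b)\<^sup>2 + (v \<bullet> spin b)\<^sup>2)"
  note on = assms(3-5)
  \<comment> \<open>Normalisation of the state makes the weights \<open>?p\<close> a probability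
    distribution, so a constant is its own mean.\<close>
  have total: "(\<Sum>b\<in>UNIV. ?p b * real CARD('n)) = real CARD('n)"
    using assms(1) by (simp add: sum_distrib_right[symmetric] sum_norm_square_nth)
  have qfi: "qfi \<psi>\<^sub>0 \<theta> w + qfi \<psi>\<^sub>0 \<theta> v
      = ?Q - (w \<bullet> mean_spin \<psi>\<^sub>0)\<^sup>2 - (v \<bullet> mean_spin \<psi>\<^sub>0)\<^sup>2"
    by (simp add: qfi_eq_variance[OF assms(1)] distrib_left sum.distrib)
  have bound: "(w \<bullet> spin b)\<^sup>2 + (v \<bullet> spin b)\<^sup>2 \<le> real CARD('n)" for b
    using Bessel_two[OF on, of "spin b"] by (simp add: inner_spin_self)
  have "?Q \<le> (\<Sum>b\<in>UNIV. ?p b * real CARD('n))"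
    by (intro sum_mono mult_left_mono bound) simp
  then have le: "qfi \<psi>\<^sub>0 \<theta> w + qfi \<psi>\<^sub>0 \<theta> v \<le> real CARD('n)"
    unfolding qfi total
    using zero_le_power2[of "w \<bullet> mean_spin \<psi>\<^sub>0"] zero_le_power2[of "v \<bullet> mean_spin \<psi>\<^sub>0"] by linarith
  have "qfi \<psi>\<^sub>0 \<theta> w + qfi \<psi>\<^sub>0 \<theta> v = real CARD('n)" if "CARD('n) = 2" "equatorial \<psi>\<^sub>0"
  proof -
    have "mean_spin \<psi>\<^sub>0 = 0"
      using that(2) by (simp add: equatorial_def expectation_sigma_z vec_eq_iff)
    \<comment> \<open>Here \<open>real ^ 'n\<close> has dimension \<open>CARD('n) = 2\<close>, so
      the pointwise bound is attained at every \<open>b\<close>.\<close>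
    moreover have "(w \<bullet> spin b)\<^sup>2 + (v \<bullet> spin b)\<^sup>2 = real CARD('n)" for b
      using Parseval_two[OF on] that(1) by (simp add: inner_spin_self)
    ultimately show ?thesis
      unfolding qfi using total by simp
  qed
  with le show ?thesis by blast
qed

end
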